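(* For positive integers $k,s$, $\mu(k,s)\leq k\cdot(\mu(k,s,(k-1))-1)+1$. Similarly, for positive integers $k,p,q$, $\mu(k,p,q)\leq k\cdot(\mu(k,p,q,(k-1))-1)+1$.
   Context: A literal is a propositional variable $x$ or its negation $\overline{x}$; a clause is a finite set of literals not containing both a literal and its negation; a CNF formula is a finite set of clauses. A $(k,s)$-formula is a CNF formula in which every clause contains exactly $k$ distinct literals and every variable occurs in at most $s$ clauses; a $(\leq k,s)$-formula is the same with every clause containing at most $k$ literals. A $(k,p,q)$-formula is a CNF formula in which every clause contains exactly $k$ distinct literals and every variable occurs positively in at most $p$ clauses and negatively in at most $q$ clauses; a $(\leq k,p,q)$-formula is the same with every clause containing at most $k$ literals. A stairway is a finite non-increasing sequence $\sigma=(a_1,\dots,a_r)$ of positive integers; for fixed $k$, a formula $F$ has stairway $\sigma$ if its clauses can be enumerated as $C_1,\dots,C_m$ with $|C_i|=k-a_i$ for $i\leq r$ and $|C_i|=k$ for $i>r$. Thus stairway $(k-1)$ means exactly one clause has one literal and all others have $k$ literals. $\mu(k,s)$ and $\mu(k,p,q)$ are the numbers of clauses of smallest unsatisfiable $(k,s)$- resp. $(k,p,q)$-formulas; $\mu(k,s,\sigma)$ and $\mu(k,p,q,\sigma)$ are the numbers of clauses of smallest unsatisfiable $(\leq k,s)$- resp. $(\leq k,p,q)$-formulas with stairway $\sigma$ (each $\infty$ if none exists). *)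

theory Defs
  imports Main "HOL-Library.Extended_Nat"
begin

datatype 'v literal = Pos 'v | Neg 'v

type_synonym 'v clause = "'v literal set"
type_synonym 'v formula = "'v clause set"

definition is_clause :: "'v clause \<Rightarrow> bool" where
  "is_clause C \<longleftrightarrow> finite C \<and> \<not> (\<exists>x. Pos x \<in> C \<and> Neg x \<in> C)"

definition is_cnf :: "'v formula \<Rightarrow> bool" where
  "is_cnf F \<longleftrightarrow> finite F \<and> (\<forall>C\<in>F. is_clause C)"

fun lit_true :: "('v \<Rightarrow> bool) \<Rightarrow> 'v literal \<Rightarrow> bool" where
  "lit_true \<tau> (Pos x) = \<tau> x"
| "lit_true \<tau> (Neg x) = (\<not> \<tau> x)"

definition satisfiable :: "'v formula \<Rightarrow> bool" where
  "satisfiable F \<longleftrightarrow> (\<exists>\<tau>. \<forall>C\<in>F. \<exists>l\<in>C. lit_true \<tau> l)"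

definition occ_le :: "nat \<Rightarrow> 'v formula \<Rightarrow> bool" where
  "occ_le s F \<longleftrightarrow> (\<forall>x. card {C\<in>F. Pos x \<in> C \<or> Neg x \<in> C} \<le> s)"

definition signed_occ_le :: "nat \<Rightarrow> nat \<Rightarrow> 'v formula \<Rightarrow> bool" where
  "signed_occ_le p q F \<longleftrightarrow>
     (\<forall>x. card {C\<in>F. Pos x \<in> C} \<le> p \<and> card {C\<in>F. Neg x \<in> C} \<le> q)"

definition ks_formula :: "nat \<Rightarrow> nat \<Rightarrow> 'v formula \<Rightarrow> bool" where
  "ks_formula k s F \<longleftrightarrow> is_cnf F \<and> (\<forall>C\<in>F. card C = k) \<and> occ_le s F"

definition le_ks_formula :: "nat \<Rightarrow> nat \<Rightarrow> 'v formula \<Rightarrow> bool" where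
  "le_ks_formula k s F \<longleftrightarrow> is_cnf F \<and> (\<forall>C\<in>F. card C \<le> k) \<and> occ_le s F"

definition kpq_formula :: "nat \<Rightarrow> nat \<Rightarrow> nat \<Rightarrow> 'v formula \<Rightarrow> bool" where
  "kpq_formula k p q F \<longleftrightarrow> is_cnf F \<and> (\<forall>C\<in>F. card C = k) \<and> signed_occ_le p q F"

definition le_kpq_formula :: "nat \<Rightarrow> nat \<Rightarrow> nat \<Rightarrow> 'v formula \<Rightarrow> bool" where
  "le_kpq_formula k p q F \<longleftrightarrow> is_cnf F \<and> (\<forall>C\<in>F. card C \<le> k) \<and> signed_occ_le p q F"

text \<open>
  The size condition is written additively, so that an entry larger than \<open>k\<close> is not
  silently truncated. A stairway consists of positive integers; the entry \<open>0\<close> is also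
  admitted here, so that \<open>[k - 1]\<close> keeps its intended meaning (one clause with one literal,
  all others with \<open>k\<close> literals) in the degenerate case \<open>k = 1\<close>, instead of making the
  predicate false there.
\<close>

definition has_stairway :: "nat \<Rightarrow> nat list \<Rightarrow> 'v formula \<Rightarrow> bool" where
  "has_stairway k \<sigma> F \<longleftrightarrow>
     sorted_wrt (\<ge>) \<sigma> \<and>
     (\<exists>Cs. distinct Cs \<and> set Cs = F \<and> length \<sigma> \<le> length Cs \<and>
        (\<forall>i < length Cs. if i < length \<sigma> then card (Cs ! i) + \<sigma> ! i = k
                         else card (Cs ! i) = k))"

text \<open>
  Variables are drawn from the countably infinite supply \<^typ>\<open>nat\<close>. In \<^typ>\<open>enat\<close> the
  infimum of a nonempty set is its least element and that of the empty set is \<open>\<infinity>\<close>.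
\<close>

definition mu_s :: "nat \<Rightarrow> nat \<Rightarrow> enat" where
  "mu_s k s = Inf {enat (card F) | F :: nat formula. ks_formula k s F \<and> \<not> satisfiable F}"

definition mu_pq :: "nat \<Rightarrow> nat \<Rightarrow> nat \<Rightarrow> enat" where
  "mu_pq k p q = Inf {enat (card F) | F :: nat formula. kpq_formula k p q F \<and> \<not> satisfiable F}"

definition mu_s_stair :: "nat \<Rightarrow> nat \<Rightarrow> nat list \<Rightarrow> enat" where
  "mu_s_stair k s \<sigma> =
     Inf {enat (card F) | F :: nat formula.
            le_ks_formula k s F \<and> has_stairway k \<sigma> F \<and> \<not> satisfiable F}"

definition mu_pq_stair :: "nat \<Rightarrow> nat \<Rightarrow> nat \<Rightarrow> nat list \<Rightarrow> enat" where
  "mu_pq_stair k p q \<sigma> =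
     Inf {enat (card F) | F :: nat formula.
            le_kpq_formula k p q F \<and> has_stairway k \<sigma> F \<and> \<not> satisfiable F}"

end

theory Submission
  imports Defs "HOL-Library.Nat_Bijection"
begin

text \<open>
  Take \<open>k\<close> variable-disjoint copies of an unsatisfiable formula whose only short clause is the
  unit clause \<open>{l}\<close>, and merge the \<open>k\<close> copies of this unit clause into a single clause of
  size \<open>k\<close>. An assignment satisfying the merged clause makes one of its literals true, and hence
  would satisfy the corresponding copy of the original formula. Every variable occurs as often
  as before, because merging only enlarges the clause in which the copy of \<open>l\<close> occurs.
\<close>

text \<open>Pairing index and variable keeps the copies variable-disjoint while staying over
  \<open>nat\<close>, the variable type fixed in \<open>mu_s\<close> and
  \<open>mu_pq\<close>.\<close>

definition copy_lit :: "nat \<Rightarrow> nat literal \<Rightarrow> nat literal" where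
  "copy_lit i = map_literal (\<lambda>x. prod_encode (i, x))"

definition merged_clause :: "nat \<Rightarrow> nat literal \<Rightarrow> nat clause" where
  "merged_clause k l = (\<lambda>i. copy_lit i l) ` {..<k}"

definition merged_copies :: "nat \<Rightarrow> nat literal \<Rightarrow> nat formula \<Rightarrow> nat formula" where
  "merged_copies k l F =
     insert (merged_clause k l) (\<Union>i<k. (`) (copy_lit i) ` (F - {{l}}))"

lemma copy_lit_simps [simp]:
  "copy_lit i (Pos x) = Pos (prod_encode (i, x))"
  "copy_lit i (Neg x) = Neg (prod_encode (i, x))"
  by (simp_all add: copy_lit_def)

lemma copy_lit_eq_iff [simp]: "copy_lit i l = copy_lit j m \<longleftrightarrow> i = j \<and> l = m"
  by (cases l; cases m) auto

lemma lit_true_copy_lit: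
  "lit_true \<tau> (copy_lit i l) \<longleftrightarrow> lit_true (\<lambda>x. \<tau> (prod_encode (i, x))) l"
  by (cases l) auto

lemma Pos_eq_copy_lit_iff:
  "Pos y = copy_lit i l \<longleftrightarrow> (\<exists>x. l = Pos x \<and> y = prod_encode (i, x))"
  by (cases l) auto

lemma Neg_eq_copy_lit_iff:
  "Neg y = copy_lit i l \<longleftrightarrow> (\<exists>x. l = Neg x \<and> y = prod_encode (i, x))"
  by (cases l) auto

lemma is_clause_copy: "is_clause C \<Longrightarrow> is_clause (copy_lit i ` C)"
  by (auto simp: is_clause_def Pos_eq_copy_lit_iff Neg_eq_copy_lit_iff image_iff)

text \<open>All literals are copies of the same \<open>l\<close>, so they have the same sign and
  cannot clash.\<close>

lemma is_clause_merged_clause: "is_clause (merged_clause k l)"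
  by (cases l) (auto simp: is_clause_def merged_clause_def)

lemma card_copy: "card (copy_lit i ` C) = card C"
  by (simp add: card_image inj_on_def)

lemma card_merged_clause: "card (merged_clause k l) = k"
  by (simp add: merged_clause_def card_image inj_on_def)

lemma is_cnf_merged_copies: "is_cnf F \<Longrightarrow> is_cnf (merged_copies k l F)"
  by (auto simp: is_cnf_def merged_copies_def is_clause_copy is_clause_merged_clause)

lemma card_clause_merged_copies:
  assumes "\<forall>C\<in>F - {{l}}. card C = k" and "C \<in> merged_copies k l F"
  shows "card C = k"
  using assms by (auto simp: merged_copies_def card_merged_clause card_copy)

lemma unsatisfiable_merged_copies:
  assumes "\<not> satisfiable F"
  shows "\<not> satisfiable (merged_copies k l F)"
proof
  assume "satisfiable (merged_copies k l F)"
  then obtain \<tau> where \<tau>: "\<And>C. C \<in> merged_copies k l F \<Longrightarrow> \<exists>m\<in>C. lit_true \<tau> m"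
    by (auto simp: satisfiable_def)
  have "\<exists>m\<in>merged_clause k l. lit_true \<tau> m"
    by (rule \<tau>) (simp add: merged_copies_def)
  then obtain i where i: "i < k" "lit_true \<tau> (copy_lit i l)"
    by (auto simp: merged_clause_def)
  \<comment> \<open>Pull \<tau> back along the i-th copy: \<open>{l}\<close> holds by the choice of
    \<open>i\<close>, any other clause because its i-th copy was kept.\<close>
  have "\<exists>m\<in>C. lit_true (\<lambda>x. \<tau> (prod_encode (i, x))) m" if "C \<in> F" for C
  proof (cases "C = {l}")
    case True
    then show ?thesis using i by (simp add: lit_true_copy_lit)
  next
    case False
    then have "copy_lit i ` C \<in> merged_copies k l F"
      using i(1) that by (auto simp: merged_copies_def)
    from \<tau>[OF this] show ?thesis by (auto simp: lit_true_copy_lit)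
  qed
  then show False using assms unfolding satisfiable_def by blast
qed

lemma card_merged_copies_le:
  assumes "finite F" and "{l} \<in> F"
  shows "card (merged_copies k l F) \<le> k * (card F - 1) + 1"
proof -
  let ?U = "\<Union>i<k. (`) (copy_lit i) ` (F - {{l}})"
  have "card ?U \<le> (\<Sum>i<k. card ((`) (copy_lit i) ` (F - {{l}})))"
    by (rule card_UN_le) simp
  \<comment> \<open>The unit clause is removed from each copy, hence
    \<open>card F - 1\<close>.\<close>
  also have "\<dots> \<le> (\<Sum>i<k. card F - 1)"
    using assms by (intro sum_mono order_trans[OF card_image_le]) auto
  finally have "card ?U \<le> k * (card F - 1)" by simp
  then show ?thesis
    using assms(1) by (simp add: merged_copies_def card_insert_if)
qed

text \<open>
  Taking \<open>M\<close> to be \<open>{Pos x, Neg x}\<close>, \<open>{Pos x}\<close> or \<open>{Neg x}\<close> covers both kinds of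
  occurrence bounds.
\<close>

lemma card_occ_merged_copies_le:
  assumes "finite F" and "{l} \<in> F"
  shows "card {C \<in> merged_copies k l F. C \<inter> copy_lit i ` M \<noteq> {}} \<le> card {C \<in> F. C \<inter> M \<noteq> {}}"
proof -
  \<comment> \<open>\<open>g\<close> sends each clause of \<open>F\<close> to its counterpart in
    copy \<open>i\<close>, the unit clause going to the merged one. Clauses meeting copy
    \<open>i\<close> of \<open>M\<close> all arise this way from clauses meeting \<open>M\<close>,
    which bounds their number.\<close>
  define g where "g C = (if C = {l} then merged_clause k l else copy_lit i ` C)" for C
  have "{C \<in> merged_copies k l F. C \<inter> copy_lit i ` M \<noteq> {}} \<subseteq> g ` {C \<in> F. C \<inter> M \<noteq> {}}"
  proof
    fix C assume "C \<in> {C \<in> merged_copies k l F. C \<inter> copy_lit i ` M \<noteq> {}}"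
    then consider "C = merged_clause k l" "C \<inter> copy_lit i ` M \<noteq> {}"
      | j D where "D \<in> F" "D \<noteq> {l}" "C = copy_lit j ` D" "C \<inter> copy_lit i ` M \<noteq> {}"
      unfolding merged_copies_def by blast
    then show "C \<in> g ` {C \<in> F. C \<inter> M \<noteq> {}}"
    proof cases
      case 1
      then have "l \<in> M" by (auto simp: merged_clause_def)
      then show ?thesis
        using 1 assms(2) by (intro image_eqI[of _ _ "{l}"]) (auto simp: g_def)
    next
      case 2
      \<comment> \<open>A common literal determines both its copy index and its original.\<close>
      then have "j = i" "D \<inter> M \<noteq> {}" by auto
      then show ?thesis
        using 2 by (intro image_eqI[of _ _ D]) (auto simp: g_def)
    qed
  qed
  then show ?thesis using assms(1) by (intro surj_card_le) auto
qed

lemma occ_le_merged_copies: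
  assumes "finite F" and "{l} \<in> F" and "occ_le s F"
  shows "occ_le s (merged_copies k l F)"
  unfolding occ_le_def
proof
  fix y
  \<comment> \<open>The pairing is onto, so every variable lies in some copy, possibly one with
    index at least \<open>k\<close>, where nothing occurs.\<close>
  obtain i x where y: "y = prod_encode (i, x)"
    by (metis prod_decode_inverse surj_pair)
  have "card {C \<in> F. C \<inter> {Pos x, Neg x} \<noteq> {}} \<le> s"
    using assms(3) by (simp add: occ_le_def disj_commute)
  with card_occ_merged_copies_le[OF assms(1,2), of k i "{Pos x, Neg x}"]
  show "card {C \<in> merged_copies k l F. Pos y \<in> C \<or> Neg y \<in> C} \<le> s"
    by (simp add: y disj_commute)
qed

lemma signed_occ_le_merged_copies:
  assumes "finite F" and "{l} \<in> F" and "signed_occ_le p q F"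
  shows "signed_occ_le p q (merged_copies k l F)"
  unfolding signed_occ_le_def
proof
  fix y
  obtain i x where y: "y = prod_encode (i, x)"
    by (metis prod_decode_inverse surj_pair)
  have "card {C \<in> F. Pos x \<in> C} \<le> p" "card {C \<in> F. Neg x \<in> C} \<le> q"
    using assms(3) by (auto simp: signed_occ_le_def)
  with card_occ_merged_copies_le[OF assms(1,2), of k i "{Pos x}"]
    card_occ_merged_copies_le[OF assms(1,2), of k i "{Neg x}"]
  show "card {C \<in> merged_copies k l F. Pos y \<in> C} \<le> p \<and>
        card {C \<in> merged_copies k l F. Neg y \<in> C} \<le> q"
    by (simp add: y)
qed

lemma has_stairway_unitE:
  assumes "has_stairway k [k - 1] F" and "k > 0"
  obtains l where "{l} \<in> F" and "\<forall>C\<in>F - {{l}}. card C = k"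
proof -
  obtain Cs where Cs: "set Cs = F" "length [k - 1] \<le> length Cs"
    "\<forall>i < length Cs. if i < length [k - 1] then card (Cs ! i) + [k - 1] ! i = k
                      else card (Cs ! i) = k"
    using assms(1) unfolding has_stairway_def by blast
  \<comment> \<open>For positive \<open>k\<close> the subtraction \<open>k - 1\<close> does not
    truncate. For \<open>k = 1\<close> all clauses are units and \<open>l\<close> comes from the
    first.\<close>
  have "card (Cs ! 0) = 1" using Cs(2) Cs(3)[rule_format, of 0] assms(2) by fastforce
  then obtain l where l: "Cs ! 0 = {l}" by (rule card_1_singletonE)
  have "card C = k" if C: "C \<in> F - {{l}}" for C
  proof -
    obtain i where i: "i < length Cs" "C = Cs ! i"
      using C Cs(1) by (metis DiffD1 in_set_conv_nth)
    with C l have "i \<noteq> 0" by auto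
    then show ?thesis using Cs(3) i by simp
  qed
  moreover have "{l} \<in> F" using Cs(1,2) l nth_mem[of 0 Cs] by fastforce
  ultimately show ?thesis using that by blast
qed

text \<open>Passes from a construction on formulas to the minima; abstract \<open>P\<close> and
  \<open>Q\<close> serve both halves of the theorem.\<close>

lemma Inf_card_le_affine:
  fixes P Q :: "'a set \<Rightarrow> bool"
  assumes "k > 0"
    and "\<And>F. Q F \<Longrightarrow> \<exists>G. P G \<and> card G \<le> k * (card F - 1) + 1"
  shows "Inf {enat (card F) | F. P F} \<le> enat k * (Inf {enat (card F) | F. Q F} - 1) + 1"
proof (cases "\<exists>F. Q F")
  case True
  then obtain F where "Q F" ..
  then have "enat (card F) \<in> {enat (card F) | F. Q F}" by blast
  then have "Inf {enat (card F) | F. Q F} \<in> {enat (card F) | F. Q F}"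
    \<comment> \<open>\<open>enat\<close> is well-ordered, so the infimum is attained by some
      formula.\<close>
    by (rule wellorder_InfI)
  then obtain F where F: "Q F" "Inf {enat (card F) | F. Q F} = enat (card F)" by auto
  obtain G where G: "P G" "card G \<le> k * (card F - 1) + 1" using assms(2) F(1) by blast
  have "Inf {enat (card F) | F. P F} \<le> enat (card G)"
    using G(1) by (intro Inf_lower) blast
  also have "\<dots> \<le> enat (k * (card F - 1) + 1)" using G(2) by simp
  finally show ?thesis by (simp add: F(2) one_enat_def)
next
  case False
  \<comment> \<open>The infimum of the empty set is \<infinity>, and positive \<open>k\<close> keeps
    the product infinite, since 0 times \<infinity> is 0 in \<open>enat\<close>.\<close>
  then show ?thesis using assms(1) by (simp add: top_enat_def imult_is_infinity zero_enat_def)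
qed

theorem theorem7:
  shows "(\<forall>k s :: nat. k > 0 \<longrightarrow> s > 0 \<longrightarrow>
            mu_s k s \<le> enat k * (mu_s_stair k s [k - 1] - 1) + 1) \<and>
         (\<forall>k p q :: nat. k > 0 \<longrightarrow> p > 0 \<longrightarrow> q > 0 \<longrightarrow>
            mu_pq k p q \<le> enat k * (mu_pq_stair k p q [k - 1] - 1) + 1)"
proof (intro conjI allI impI)
  fix k s :: nat
  assume k: "k > 0"
  show "mu_s k s \<le> enat k * (mu_s_stair k s [k - 1] - 1) + 1"
    unfolding mu_s_def mu_s_stair_def
  proof (rule Inf_card_le_affine[OF k])
    fix F :: "nat formula"
    assume F: "le_ks_formula k s F \<and> has_stairway k [k - 1] F \<and> \<not> satisfiable F"
    then have "has_stairway k [k - 1] F" by simp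
    then obtain l where l: "{l} \<in> F" "\<forall>C\<in>F - {{l}}. card C = k"
      using k by (rule has_stairway_unitE)
    have fin: "finite F" and cnf: "is_cnf F" and occ: "occ_le s F"
      using F by (auto simp: le_ks_formula_def is_cnf_def)
    have "ks_formula k s (merged_copies k l F)"
      using is_cnf_merged_copies[OF cnf] card_clause_merged_copies[OF l(2)]
        occ_le_merged_copies[OF fin l(1) occ]
      by (simp add: ks_formula_def)
    then show "\<exists>G :: nat formula. (ks_formula k s G \<and> \<not> satisfiable G) \<and>
        card G \<le> k * (card F - 1) + 1"
      using F unsatisfiable_merged_copies card_merged_copies_le[OF fin l(1)] by blast
  qed
next
  fix k p q :: nat
  assume k: "k > 0"
  show "mu_pq k p q \<le> enat k * (mu_pq_stair k p q [k - 1] - 1) + 1"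
    unfolding mu_pq_def mu_pq_stair_def
  proof (rule Inf_card_le_affine[OF k])
    fix F :: "nat formula"
    assume F: "le_kpq_formula k p q F \<and> has_stairway k [k - 1] F \<and> \<not> satisfiable F"
    then have "has_stairway k [k - 1] F" by simp
    then obtain l where l: "{l} \<in> F" "\<forall>C\<in>F - {{l}}. card C = k"
      using k by (rule has_stairway_unitE)
    have fin: "finite F" and cnf: "is_cnf F" and occ: "signed_occ_le p q F"
      using F by (auto simp: le_kpq_formula_def is_cnf_def)
    have "kpq_formula k p q (merged_copies k l F)"
      using is_cnf_merged_copies[OF cnf] card_clause_merged_copies[OF l(2)]
        signed_occ_le_merged_copies[OF fin l(1) occ]
      by (simp add: kpq_formula_def)
    then show "\<exists>G :: nat formula. (kpq_formula k p q G \<and> \<not> satisfiable G) \<and>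
        card G \<le> k * (card F - 1) + 1"
      using F unsatisfiable_merged_copies card_merged_copies_le[OF fin l(1)] by blast
  qed
qed

end
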